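(* Let $n,m\ge 1$ be integers, let $f,g_1,\dots,g_m\in\mathbb{R}[\bar z,z]$ be real-valued complex polynomials on $\mathbb{C}^n$ of respective degrees $k,k_1,\dots,k_m$ such that $K=\{z\in\mathbb{C}^n : g_i(z)\ge 0,\ i=1,\dots,m\}$ is compact, and let $f^{\mathrm{opt}},\rho_d,\rho,\rho_d^*,\rho^*,d^{\min}$ be as defined in the context. Then $\rho_d^*\le\rho_d$ for all $d\ge d^{\min}$, and, as $d\to+\infty$, $\rho_d^*\longrightarrow\rho^*$ (in $\mathbb{R}\cup\{\pm\infty\}$) with $\rho^*\le\rho\le f^{\mathrm{opt}}$.
   Context: Notation. For $z\in\mathbb{C}^n$, $\alpha\in\mathbb{N}^n$: $z^\alpha=z_1^{\alpha_1}\cdots z_n^{\alpha_n}$, $|\alpha|=\alpha_1+\dots+\alpha_n$, $\bar z$ is the componentwise conjugate. $\mathbb{C}_d[z]$ is the set of holomorphic polynomials $\sum_{|\alpha|\le d}p_\alpha z^\alpha$ ($p_\alpha\in\mathbb{C}$), and $\mathbb{C}[z]=\bigcup_d\mathbb{C}_d[z]$. $\mathbb{R}_d[\bar z,z]$ is the set of functions $\sum_{|\alpha|,|\beta|\le d}\varphi_{\alpha,\beta}\bar z^\alpha z^\beta$ ($\varphi_{\alpha,\beta}\in\mathbb{C}$) that are real-valued on $\mathbb{C}^n$ (equivalently $\overline{\varphi_{\alpha,\beta}}=\varphi_{\beta,\alpha}$), and $\mathbb{R}[\bar z,z]=\bigcup_d\mathbb{R}_d[\bar z,z]$. $\Sigma_d[z]$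 (resp. $\Sigma[z]$) is the set of finite sums $\sum_{j=1}^r|p_j|^2$, $r\geq 1$, with $p_j\in\mathbb{C}_d[z]$ (resp. $\mathbb{C}[z]$). Degrees. $f\in\mathbb{R}_k[\bar z,z]$, $g_i\in\mathbb{R}_{k_i}[\bar z,z]$, where there exist $|\alpha|=k$, $|\beta|\le k$ with $f_{\alpha,\beta}\ne0$, and $|\alpha|=k_i$, $|\beta|\le k_i$ with $g_{i,\alpha,\beta}\neq0$. Put $g_0:=1$, $k_0:=0$, $d^{\min}:=\max\{k,k_1,\dots,k_m\}$. Problem. $f^{\mathrm{opt}}:=\inf_{z\in K}f(z)$ ($+\infty$ if $K=\emptyset$). Moments. $\mathcal{H}$ (resp. $\mathcal{H}_d$) is the set of complex families $y=(y_{\alpha,\beta})$ indexed by $\alpha,\beta\in\mathbb{N}^n$ (resp. $|\alpha|,|\beta|\le d$) with $\overline{y_{\alpha,\beta}}=y_{\beta,\alpha}$. $L_y$ is the linear functional with $L_y(\bar z^\alpha z^\beta)=y_{\alpha,\beta}$. For $\varphi=\sum\varphi_{\gamma,\delta}\bar z^\gamma z^\delta$, $M_d(\varphi y)$ is the matrix indexed by $|\alpha|,|\beta|\le d$ with entries $M_d(\varphi y)(\alpha,\beta)=L_y(\varphi\,\bar z^\alpha z^\beta)=\sum_{\gamma,\delta}\varphi_{\gamma,\delta}\,y_{\alpha+\gamma,\beta+\delta}$. Relaxations. For $d\ge d^{\min}$, $$\rho_d:=\inf_{y\in\mathcal{H}_d}L_y(f)\ \text{ s.t. } y_{0,0}=1,\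 M_{d-k_i}(g_iy)\succcurlyeq0,\ i=0,\dots,m,$$ $$\rho_d^*:=\sup\Big\{\lambda\in\mathbb{R} : f-\lambda=\sum_{i=0}^m\sigma_ig_i,\ \sigma_i\in\Sigma_{d-k_i}[z]\Big\},$$ $$\rho:=\inf_{y\in\mathcal{H}}L_y(f)\ \text{ s.t. } y_{0,0}=1,\ M_{d-k_i}(g_iy)\succcurlyeq0,\ i=0,\dots,m,\ \forall d\ge d^{\min},$$ $$\rho^*:=\sup\Big\{\lambda\in\mathbb{R} : f-\lambda=\sum_{i=0}^m\sigma_ig_i,\ \sigma_i\in\Sigma[z]\Big\}.$$ An infimum over the empty set is $+\infty$, a supremum over the empty set is $-\infty$. *)

theory Defs
  imports "HOL-Analysis.Analysis" "HOL-Library.Poly_Mapping"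
begin

text \<open>
  The exponents are vectors \<open>\<alpha> :: nat ^ 'n\<close>, and the dimension of the ambient space is the cardinality
  of the finite index type \<open>'n\<close>.  The finitely supported family \<open>\<phi>\<close> stands for the polynomial
  whose monomial with exponent \<open>\<alpha>\<close> in the conjugate variables and \<open>\<beta>\<close> in the variables
  themselves has coefficient \<open>lookup \<phi> (\<alpha>, \<beta>)\<close>.  The ring structure is that of \<open>poly_mapping\<close>.
\<close>

type_synonym 'n cpoly = "(nat ^ 'n) \<times> (nat ^ 'n) \<Rightarrow>\<^sub>0 complex"

definition mdeg :: "nat ^ 'n::finite \<Rightarrow> nat"
  where "mdeg \<alpha> = (\<Sum>i\<in>UNIV. \<alpha> $ i)"

definition mpow :: "complex ^ 'n::finite \<Rightarrow> nat ^ 'n \<Rightarrow> complex"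
  where "mpow z \<alpha> = (\<Prod>i\<in>UNIV. (z $ i) ^ (\<alpha> $ i))"

definition vcnj :: "complex ^ 'n::finite \<Rightarrow> complex ^ 'n"
  where "vcnj z = (\<chi> i. cnj (z $ i))"

definition ceval :: "'n::finite cpoly \<Rightarrow> complex ^ 'n \<Rightarrow> complex"
  where "ceval \<phi> z =
    (\<Sum>(\<alpha>, \<beta>)\<in>Poly_Mapping.keys \<phi>. Poly_Mapping.lookup \<phi> (\<alpha>, \<beta>) * mpow (vcnj z) \<alpha> * mpow z \<beta>)"

definition cmonom :: "nat ^ 'n::finite \<Rightarrow> nat ^ 'n \<Rightarrow> 'n cpoly"
  where "cmonom \<alpha> \<beta> = Poly_Mapping.single (\<alpha>, \<beta>) 1"

definition real_cpolys :: "nat \<Rightarrow> 'n::finite cpoly set"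
  where "real_cpolys d =
    {\<phi>. (\<forall>(\<alpha>, \<beta>)\<in>Poly_Mapping.keys \<phi>. mdeg \<alpha> \<le> d \<and> mdeg \<beta> \<le> d) \<and> (\<forall>z. ceval \<phi> z \<in> \<real>)}"

text \<open>By this convention the zero polynomial has no degree.\<close>

definition has_cdegree :: "'n::finite cpoly \<Rightarrow> nat \<Rightarrow> bool"
  where "has_cdegree \<phi> k \<longleftrightarrow> \<phi> \<in> real_cpolys k \<and>
    (\<exists>\<alpha> \<beta>. mdeg \<alpha> = k \<and> mdeg \<beta> \<le> k \<and> Poly_Mapping.lookup \<phi> (\<alpha>, \<beta>) \<noteq> 0)"

lemma finite_mdeg_le: "finite {\<alpha> :: nat ^ 'n::finite. mdeg \<alpha> \<le> d}"
proof (rule finite_subset)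
  show "{\<alpha> :: nat ^ 'n. mdeg \<alpha> \<le> d} \<subseteq> vec_lambda ` (UNIV \<rightarrow>\<^sub>E {..d})"
  proof
    fix \<alpha> :: "nat ^ 'n" assume "\<alpha> \<in> {\<alpha>. mdeg \<alpha> \<le> d}"
    then have "\<alpha> $ i \<le> d" for i
      using member_le_sum[of i UNIV "\<lambda>i. \<alpha> $ i"] by (simp add: mdeg_def)
    then have "vec_nth \<alpha> \<in> UNIV \<rightarrow>\<^sub>E {..d}" by auto
    then show "\<alpha> \<in> vec_lambda ` (UNIV \<rightarrow>\<^sub>E {..d})"
      by (metis image_eqI vec_nth_inverse)
  qed
  show "finite (vec_lambda ` (UNIV \<rightarrow>\<^sub>E {..d}) :: (nat ^ 'n) set)"
    by (intro finite_imageI finite_PiE) auto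
qed

definition hol_polys :: "nat \<Rightarrow> (complex ^ 'n::finite \<Rightarrow> complex) set"
  where "hol_polys d = {\<lambda>z. \<Sum>\<alpha> | mdeg \<alpha> \<le> d. p \<alpha> * mpow z \<alpha> | p. True}"

definition sums_sq :: "(complex ^ 'n::finite \<Rightarrow> complex) set \<Rightarrow> (complex ^ 'n \<Rightarrow> real) set"
  where "sums_sq P = {\<sigma>. \<exists>r\<ge>1. \<exists>p. (\<forall>j\<in>{1..r::nat}. p j \<in> P) \<and>
    \<sigma> = (\<lambda>z. \<Sum>j=1..r. (cmod (p j z))\<^sup>2)}"

definition Sigma_deg :: "nat \<Rightarrow> (complex ^ 'n::finite \<Rightarrow> real) set"
  where "Sigma_deg d = sums_sq (hol_polys d)"

definition Sigma_all :: "(complex ^ 'n::finite \<Rightarrow> real) set"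
  where "Sigma_all = sums_sq (\<Union>d. hol_polys d)"

definition herm_seqs :: "(nat ^ 'n::finite \<Rightarrow> nat ^ 'n \<Rightarrow> complex) set"
  where "herm_seqs = {y. \<forall>\<alpha> \<beta>. cnj (y \<alpha> \<beta>) = y \<beta> \<alpha>}"

text \<open>Truncated families are represented by their extension by zero.\<close>

definition herm_seqs_deg :: "nat \<Rightarrow> (nat ^ 'n::finite \<Rightarrow> nat ^ 'n \<Rightarrow> complex) set"
  where "herm_seqs_deg d = {y.
    (\<forall>\<alpha> \<beta>. mdeg \<alpha> \<le> d \<and> mdeg \<beta> \<le> d \<longrightarrow> cnj (y \<alpha> \<beta>) = y \<beta> \<alpha>) \<and>
    (\<forall>\<alpha> \<beta>. \<not> (mdeg \<alpha> \<le> d \<and> mdeg \<beta> \<le> d) \<longrightarrow> y \<alpha> \<beta> = 0)}"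

definition riesz :: "(nat ^ 'n::finite \<Rightarrow> nat ^ 'n \<Rightarrow> complex) \<Rightarrow> 'n cpoly \<Rightarrow> complex"
  where "riesz y \<phi> = (\<Sum>(\<alpha>, \<beta>)\<in>Poly_Mapping.keys \<phi>. Poly_Mapping.lookup \<phi> (\<alpha>, \<beta>) * y \<alpha> \<beta>)"

definition loc_matrix ::
  "'n::finite cpoly \<Rightarrow> (nat ^ 'n \<Rightarrow> nat ^ 'n \<Rightarrow> complex) \<Rightarrow> nat ^ 'n \<Rightarrow> nat ^ 'n \<Rightarrow> complex"
  where "loc_matrix \<phi> y \<alpha> \<beta> = riesz y (\<phi> * cmonom \<alpha> \<beta>)"

definition psd_on :: "'i set \<Rightarrow> ('i \<Rightarrow> 'i \<Rightarrow> complex) \<Rightarrow> bool"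
  where "psd_on I M \<longleftrightarrow> (\<forall>a\<in>I. \<forall>b\<in>I. cnj (M a b) = M b a) \<and>
    (\<forall>v. 0 \<le> Re (\<Sum>a\<in>I. \<Sum>b\<in>I. cnj (v a) * M a b * v b))"

text \<open>
  The constraints are \<open>g 1, \<dots>, g m\<close> with degrees \<open>kg 1, \<dots>, kg m\<close>.  The updates
  \<open>g(0 := 1)\<close> and \<open>kg(0 := 0)\<close> adjoin the constant constraint with index 0, so the values
  \<open>g 0\<close> and \<open>kg 0\<close> are irrelevant.
\<close>

definition feasible_set :: "nat \<Rightarrow> (nat \<Rightarrow> 'n::finite cpoly) \<Rightarrow> (complex ^ 'n) set"
  where "feasible_set m g = {z. \<forall>i\<in>{1..m}. 0 \<le> Re (ceval (g i) z)}"

definition f_opt :: "nat \<Rightarrow> 'n::finite cpoly \<Rightarrow> (nat \<Rightarrow> 'n cpoly) \<Rightarrow> ereal"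
  where "f_opt m f g = (INF z\<in>feasible_set m g. ereal (Re (ceval f z)))"

definition d_min :: "nat \<Rightarrow> nat \<Rightarrow> (nat \<Rightarrow> nat) \<Rightarrow> nat"
  where "d_min m k kg = Max (insert k (kg ` {1..m}))"

definition moment_constraints ::
  "nat \<Rightarrow> (nat \<Rightarrow> 'n::finite cpoly) \<Rightarrow> (nat \<Rightarrow> nat) \<Rightarrow> nat \<Rightarrow> (nat ^ 'n \<Rightarrow> nat ^ 'n \<Rightarrow> complex) \<Rightarrow> bool"
  where "moment_constraints m g kg d y \<longleftrightarrow>
    (\<forall>i\<in>{0..m}. psd_on {\<alpha>. mdeg \<alpha> \<le> d - (kg(0 := 0)) i} (loc_matrix ((g(0 := 1)) i) y))"

text \<open>
  As \<open>f\<close> is real-valued, \<open>riesz y f\<close> is real for Hermitian \<open>y\<close>, and \<open>Re\<close> only changes the type.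
\<close>

definition rho_deg ::
  "nat \<Rightarrow> 'n::finite cpoly \<Rightarrow> (nat \<Rightarrow> 'n cpoly) \<Rightarrow> (nat \<Rightarrow> nat) \<Rightarrow> nat \<Rightarrow> ereal"
  where "rho_deg m f g kg d =
    (INF y\<in>{y \<in> herm_seqs_deg d. y 0 0 = 1 \<and> moment_constraints m g kg d y}. ereal (Re (riesz y f)))"

definition rho ::
  "nat \<Rightarrow> 'n::finite cpoly \<Rightarrow> (nat \<Rightarrow> 'n cpoly) \<Rightarrow> nat \<Rightarrow> (nat \<Rightarrow> nat) \<Rightarrow> ereal"
  where "rho m f g k kg =
    (INF y\<in>{y \<in> herm_seqs. y 0 0 = 1 \<and> (\<forall>d\<ge>d_min m k kg. moment_constraints m g kg d y)}.
       ereal (Re (riesz y f)))"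

definition rho_dual_deg ::
  "nat \<Rightarrow> 'n::finite cpoly \<Rightarrow> (nat \<Rightarrow> 'n cpoly) \<Rightarrow> (nat \<Rightarrow> nat) \<Rightarrow> nat \<Rightarrow> ereal"
  where "rho_dual_deg m f g kg d =
    Sup {ereal l | l. \<exists>\<sigma>. (\<forall>i\<in>{0..m}. \<sigma> i \<in> Sigma_deg (d - (kg(0 := 0)) i)) \<and>
      (\<forall>z. ceval f z - of_real l = (\<Sum>i=0..m. of_real (\<sigma> i z) * ceval ((g(0 := 1)) i) z))}"

definition rho_dual ::
  "nat \<Rightarrow> 'n::finite cpoly \<Rightarrow> (nat \<Rightarrow> 'n cpoly) \<Rightarrow> ereal"
  where "rho_dual m f g =
    Sup {ereal l | l. \<exists>\<sigma>. (\<forall>i\<in>{0..m}. \<sigma> i \<in> Sigma_all) \<and>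
      (\<forall>z. ceval f z - of_real l = (\<Sum>i=0..m. of_real (\<sigma> i z) * ceval ((g(0 := 1)) i) z))}"

end

theory Submission
  imports Defs "HOL-Computational_Algebra.Polynomial"
begin

text \<open>
  A function of the form \<open>ceval \<phi>\<close> determines the coefficients of \<open>\<phi>\<close>, so a certificate
  \<open>f - \<lambda> = \<Sum>\<^sub>i \<sigma>\<^sub>i g\<^sub>i\<close> may be read as an identity of polynomials.  Applying \<open>L\<^sub>y\<close> to it turns each
  square \<open>\<bar>p\<bar>\<^sup>2 g\<^sub>i\<close> into the value at \<open>p\<close> of the quadratic form of the localizing matrix of \<open>g\<^sub>i\<close>, which
  gives weak duality.  Since any certificate has finite degree, the increasing values of the truncated
  duals exhaust those of the full dual, and evaluation at a point of \<open>K\<close> is a feasible moment family.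
\<close>

section \<open>The Riesz functional\<close>

lemma riesz_superset:
  assumes "finite S" "Poly_Mapping.keys \<phi> \<subseteq> S"
  shows "riesz y \<phi> = (\<Sum>(\<alpha>, \<beta>)\<in>S. Poly_Mapping.lookup \<phi> (\<alpha>, \<beta>) * y \<alpha> \<beta>)"
  unfolding riesz_def using assms
  by (intro sum.mono_neutral_left) (auto simp: in_keys_iff)

lemma riesz_zero [simp]: "riesz y 0 = 0"
  by (simp add: riesz_def)

lemma riesz_add: "riesz y (\<phi> + \<psi>) = riesz y \<phi> + riesz y \<psi>"
proof -
  let ?S = "Poly_Mapping.keys \<phi> \<union> Poly_Mapping.keys \<psi>"
  have "Poly_Mapping.keys (\<phi> + \<psi>) \<subseteq> ?S" by (rule Poly_Mapping.keys_add)
  then show ?thesis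
    by (simp add: riesz_superset[of ?S] lookup_add distrib_right sum.distrib case_prod_unfold)
qed

lemma riesz_diff: "riesz y (\<phi> - \<psi>) = riesz y \<phi> - riesz y \<psi>"
  using riesz_add[of y "\<phi> - \<psi>" \<psi>] by simp

lemma riesz_sum: "riesz y (\<Sum>i\<in>A. \<phi> i) = (\<Sum>i\<in>A. riesz y (\<phi> i))"
  by (induction A rule: infinite_finite_induct) (auto simp: riesz_add)

lemma riesz_single: "riesz y (Poly_Mapping.single (\<alpha>, \<beta>) c) = c * y \<alpha> \<beta>"
  by (simp add: riesz_def)

text \<open>Splitting \<open>\<phi>\<close> into monomials reduces the product to shifts of
  exponents. The sum runs over the keys of \<open>\<phi>\<close>, so the support of the product
  never has to be computed.\<close>

lemma riesz_mult_single:
  "riesz y (\<phi> * Poly_Mapping.single (\<alpha>, \<beta>) c) =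
    c * (\<Sum>(\<gamma>, \<delta>)\<in>Poly_Mapping.keys \<phi>. Poly_Mapping.lookup \<phi> (\<gamma>, \<delta>) * y (\<gamma> + \<alpha>) (\<delta> + \<beta>))"
proof -
  have "\<phi> = (\<Sum>x\<in>Poly_Mapping.keys \<phi>. Poly_Mapping.single x (Poly_Mapping.lookup \<phi> x))"
    by (rule poly_mapping_eqI) (simp add: lookup_sum lookup_single when_def in_keys_iff)
  then have "\<phi> * Poly_Mapping.single (\<alpha>, \<beta>) c =
      (\<Sum>x\<in>Poly_Mapping.keys \<phi>. Poly_Mapping.single (fst x + \<alpha>, snd x + \<beta>) (Poly_Mapping.lookup \<phi> x * c))"
    by (metis (no_types, lifting) sum.cong sum_distrib_right mult_single plus_prod_def fst_conv snd_conv)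
  then show ?thesis
    by (simp add: riesz_sum riesz_single sum_distrib_left case_prod_unfold mult_ac)
qed

lemma riesz_mult_single_eq_loc_matrix:
  "riesz y (\<phi> * Poly_Mapping.single (\<alpha>, \<beta>) c) = c * loc_matrix \<phi> y \<alpha> \<beta>"
  unfolding loc_matrix_def cmonom_def by (simp only: riesz_mult_single mult_1)

section \<open>Evaluation as a moment family\<close>

text \<open>The moments of the unit point mass at \<open>z\<close>. Evaluation becomes a case of the
  Riesz functional and inherits its linearity.\<close>

definition dirac :: "complex ^ 'n::finite \<Rightarrow> nat ^ 'n \<Rightarrow> nat ^ 'n \<Rightarrow> complex"
  where "dirac z \<alpha> \<beta> = mpow (vcnj z) \<alpha> * mpow z \<beta>"

lemma ceval_eq_riesz: "ceval \<phi> z = riesz (dirac z) \<phi>"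
  by (simp add: ceval_def riesz_def dirac_def mult.assoc)

lemma mpow_add: "mpow z (\<alpha> + \<beta>) = mpow z \<alpha> * mpow z \<beta>"
  by (simp add: mpow_def power_add prod.distrib)

lemma mpow_zero [simp]: "mpow z 0 = 1"
  by (simp add: mpow_def)

lemma mpow_vcnj: "mpow (vcnj z) \<alpha> = cnj (mpow z \<alpha>)"
  by (simp add: mpow_def vcnj_def)

text \<open>Monomials turn sums of exponents into products, so the localizing matrix of a point mass
  is a scalar multiple of a rank-one matrix.\<close>

lemma loc_matrix_dirac: "loc_matrix \<phi> (dirac z) \<alpha> \<beta> = ceval \<phi> z * (cnj (mpow z \<alpha>) * mpow z \<beta>)"
  unfolding loc_matrix_def cmonom_def riesz_mult_single
  by (simp add: ceval_def dirac_def mpow_add mpow_vcnj sum_distrib_left sum_distrib_right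
      case_prod_unfold mult_ac)

lemma ceval_one [simp]: "ceval 1 z = 1"
proof -
  have "ceval 1 z = riesz (dirac z) (Poly_Mapping.single (0, 0) 1)"
    by (simp add: ceval_eq_riesz zero_prod_def[symmetric])
  then show ?thesis by (simp add: riesz_single dirac_def)
qed

lemma cnj_mult_self: "cnj z * z = of_real ((cmod z)\<^sup>2)"
  by (metis complex_norm_square mult.commute)

text \<open>By the rank-one form, the quadratic form at \<open>v\<close> is the value of
  \<open>\<phi>\<close> at \<open>z\<close> times a squared modulus; reality of that value makes the
  matrix Hermitian.\<close>

lemma psd_on_dirac:
  assumes "ceval \<phi> z \<in> \<real>" "0 \<le> Re (ceval \<phi> z)"
  shows "psd_on I (loc_matrix \<phi> (dirac z))"
proof -
  have "0 \<le> Re (\<Sum>a\<in>I. \<Sum>b\<in>I. cnj (v a) * loc_matrix \<phi> (dirac z) a b * v b)" for v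
  proof -
    let ?s = "\<Sum>b\<in>I. v b * mpow z b"
    have "(\<Sum>a\<in>I. \<Sum>b\<in>I. cnj (v a) * loc_matrix \<phi> (dirac z) a b * v b) = ceval \<phi> z * (cnj ?s * ?s)"
      by (simp add: loc_matrix_dirac sum_product sum_distrib_left mult_ac)
    also have "cnj ?s * ?s = of_real ((cmod ?s)\<^sup>2)"
      by (rule cnj_mult_self)
    finally show ?thesis using assms by (simp only: complex.sel Re_complex_of_real times_complex.sel Im_complex_of_real) simp
  qed
  then show ?thesis
    using assms by (simp add: psd_on_def loc_matrix_dirac Reals_cnj_iff mult_ac)
qed

section \<open>Polynomials are determined by their values\<close>

text \<open>A univariate polynomial with infinitely many roots is zero. Different indices may share
  an exponent, so only the coefficients grouped by exponent are seen to vanish.\<close>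

lemma sum_power_eq_0D:
  fixes c :: "'s \<Rightarrow> 'a::idom"
  assumes "finite S" "infinite X" "\<And>x. x \<in> X \<Longrightarrow> (\<Sum>s\<in>S. c s * x ^ e s) = 0"
  shows "(\<Sum>s | s \<in> S \<and> e s = j. c s) = 0"
proof -
  define p where "p = (\<Sum>s\<in>S. monom (c s) (e s))"
  have "X \<subseteq> {x. poly p x = 0}"
    using assms(3) by (auto simp: p_def poly_sum poly_monom)
  then have "p = 0"
    using assms(2) poly_roots_finite finite_subset by blast
  then have "coeff p j = 0" by simp
  then show ?thesis
    using assms(1) by (simp add: p_def coeff_sum sum.If_cases Int_def)
qed

lemma infinite_unit_circle: "infinite {u :: complex. cmod u = 1}"
proof
  assume "finite {u :: complex. cmod u = 1}"
  moreover have "{0..1} \<subseteq> Re ` {u. cmod u = 1}"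
  proof
    fix t :: real assume "t \<in> {0..1}"
    then have "cmod (Complex t (sqrt (1 - t\<^sup>2))) = 1"
      by (simp add: cmod_def power_le_one)
    then show "t \<in> Re ` {u. cmod u = 1}"
      by (metis (mono_tags) complex.sel(1) image_eqI mem_Collect_eq)
  qed
  ultimately have "finite {0..1 :: real}"
    by (meson finite_imageI finite_subset)
  then show False by (simp add: infinite_Icc)
qed

text \<open>
  With \<open>t = r u\<close>, \<open>r\<close> real and \<open>u\<close> on the unit circle, comparing powers of \<open>r\<close> fixes \<open>a + b\<close>;
  multiplying by \<open>u ^ (a + b)\<close> then leaves the powers \<open>(u\<^sup>2) ^ b\<close>.
\<close>

lemma sum_cnj_power_eq_0D:
  fixes c :: "nat \<times> nat \<Rightarrow> complex"
  assumes S: "finite S" and 0: "\<And>t. (\<Sum>s\<in>S. c s * (cnj t ^ fst s * t ^ snd s)) = 0" and s: "s \<in> S"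
  shows "c s = 0"
proof -
  define j where "j = fst s + snd s"
  define T where "T = {s \<in> S. fst s + snd s = j}"
  have homog: "(\<Sum>s\<in>T. c s * u ^ (2 * snd s)) = 0" if u: "cmod u = 1" for u
  proof -
    have uu: "cnj u * u = 1"
      using u by (simp add: cnj_mult_self)
    have "(\<Sum>s\<in>S. (c s * (cnj u ^ fst s * u ^ snd s)) * x ^ (fst s + snd s)) = 0"
      if x: "x \<in> range complex_of_real" for x
    proof -
      obtain r where "x = of_real r" using x by blast
      then show ?thesis
        using 0[of "x * u"] by (simp add: power_mult_distrib power_add mult_ac)
    qed
    moreover have "infinite (range complex_of_real)"
      by (simp add: finite_image_iff inj_on_def infinite_UNIV_char_0)
    ultimately have "(\<Sum>s\<in>T. c s * (cnj u ^ fst s * u ^ snd s)) = 0"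
      unfolding T_def by (intro sum_power_eq_0D[OF S]) auto
    then have "0 = u ^ j * (\<Sum>s\<in>T. c s * (cnj u ^ fst s * u ^ snd s))" by simp
    also have "\<dots> = (\<Sum>s\<in>T. c s * u ^ (2 * snd s))"
      unfolding sum_distrib_left
    proof (rule sum.cong[OF refl])
      fix s assume "s \<in> T"
      then have j: "j = fst s + snd s" by (simp add: T_def)
      have "u ^ j * (c s * (cnj u ^ fst s * u ^ snd s)) =
          c s * ((cnj u * u) ^ fst s * u ^ (2 * snd s))"
        by (simp add: j power_add power_mult_distrib mult_2_right ac_simps)
      then show "u ^ j * (c s * (cnj u ^ fst s * u ^ snd s)) = c s * u ^ (2 * snd s)"
        by (simp add: uu)
    qed
    finally show ?thesis by simp
  qed
  have "finite T" using S by (simp add: T_def)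
  then have "(\<Sum>s' | s' \<in> T \<and> 2 * snd s' = 2 * snd s. c s') = 0"
    using infinite_unit_circle homog by (intro sum_power_eq_0D) auto
  \<comment> \<open>On \<open>T\<close> the sum of the two exponents is fixed, so the second one
    determines the pair.\<close>
  moreover have "{s' \<in> T. 2 * snd s' = 2 * snd s} = {s}"
    using s by (auto simp: T_def j_def prod_eq_iff)
  ultimately show ?thesis by simp
qed

text \<open>Uniqueness of digits in base \<open>N\<close>: the weights are the powers of
  \<open>N\<close>, one for each index.\<close>

lemma positional_weights:
  assumes "finite A"
  shows "\<exists>w :: 'i \<Rightarrow> nat. \<forall>a b. (\<forall>i\<in>A. a i < N \<and> b i < N) \<and>
    (\<Sum>i\<in>A. a i * w i) = (\<Sum>i\<in>A. b i * w i) \<longrightarrow> (\<forall>i\<in>A. a i = b i)"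
  using assms
proof (induction A)
  case empty
  then show ?case by simp
next
  case (insert x A)
  then obtain w :: "'i \<Rightarrow> nat" where w: "\<And>a b. \<forall>i\<in>A. a i < N \<and> b i < N \<Longrightarrow>
    (\<Sum>i\<in>A. a i * w i) = (\<Sum>i\<in>A. b i * w i) \<Longrightarrow> \<forall>i\<in>A. a i = b i"
    by blast
  \<comment> \<open>The new index becomes the lowest digit, and all earlier weights move up one
    place.\<close>
  define w' where "w' = (\<lambda>i. if i = x then 1 else N * w i)"
  have sum_w': "(\<Sum>i\<in>insert x A. a i * w' i) = a x + N * (\<Sum>i\<in>A. a i * w i)" for a
  proof -
    have "(\<Sum>i\<in>A. a i * w' i) = (\<Sum>i\<in>A. N * (a i * w i))"
      using insert.hyps by (intro sum.cong) (auto simp: w'_def)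
    then show ?thesis
      using insert.hyps by (simp add: w'_def sum_distrib_left)
  qed
  have "\<forall>i\<in>insert x A. a i = b i"
    if bnd: "\<forall>i\<in>insert x A. a i < N \<and> b i < N"
      and eq: "(\<Sum>i\<in>insert x A. a i * w' i) = (\<Sum>i\<in>insert x A. b i * w' i)" for a b
  proof -
    have N: "a x < N" "b x < N" using bnd by auto
    have eq': "a x + N * (\<Sum>i\<in>A. a i * w i) = b x + N * (\<Sum>i\<in>A. b i * w i)"
      using eq by (simp only: sum_w')
    \<comment> \<open>Reduction modulo \<open>N\<close> isolates the lowest digit.\<close>
    have "a x = b x"
      using arg_cong[OF eq', of "\<lambda>t. t mod N"] N by simp
    moreover have "\<forall>i\<in>A. a i = b i"
    proof (rule w)
      show "\<forall>i\<in>A. a i < N \<and> b i < N" using bnd by blast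
      show "(\<Sum>i\<in>A. a i * w i) = (\<Sum>i\<in>A. b i * w i)"
        using eq' \<open>a x = b x\<close> N by simp
    qed
    ultimately show ?thesis by blast
  qed
  then show ?case by (intro exI[of _ w']) blast
qed

text \<open>Kronecker substitution \<open>z\<^sub>i = t ^ w\<^sub>i\<close> reduces the claim to one variable.\<close>

lemma ceval_eq_0D:
  fixes \<phi> :: "'n::finite cpoly"
  assumes 0: "\<And>z. ceval \<phi> z = 0"
  shows "\<phi> = 0"
proof (rule poly_mapping_eqI)
  fix x
  let ?S = "Poly_Mapping.keys \<phi>"
  \<comment> \<open>The total of all degrees bounds every exponent in the support;
    \<open>Suc\<close> makes the bound strict, as digits in base \<open>N\<close> require.\<close>
  define N where "N = Suc (\<Sum>(\<alpha>, \<beta>)\<in>?S. mdeg \<alpha> + mdeg \<beta>)"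
  have bnd: "\<alpha> $ i < N" "\<beta> $ i < N" if "(\<alpha>, \<beta>) \<in> ?S" for \<alpha> \<beta> i
  proof -
    have "mdeg \<alpha> + mdeg \<beta> \<le> (\<Sum>(\<alpha>, \<beta>)\<in>?S. mdeg \<alpha> + mdeg \<beta>)"
      using member_le_sum[OF that, of "\<lambda>(\<alpha>, \<beta>). mdeg \<alpha> + mdeg \<beta>"] by simp
    moreover have "\<alpha> $ i \<le> mdeg \<alpha>" "\<beta> $ i \<le> mdeg \<beta>"
      unfolding mdeg_def by (auto intro: member_le_sum)
    ultimately show "\<alpha> $ i < N" "\<beta> $ i < N" by (auto simp: N_def)
  qed
  obtain w :: "'n \<Rightarrow> nat" where w: "\<forall>a b. (\<forall>i\<in>UNIV. a i < N \<and> b i < N) \<and>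
      (\<Sum>i\<in>UNIV. a i * w i) = (\<Sum>i\<in>UNIV. b i * w i) \<longrightarrow> (\<forall>i\<in>UNIV. a i = b i)"
    using positional_weights[OF finite, of "UNIV :: 'n set" N] by (elim exE)
  define h where "h = (\<lambda>\<alpha> :: nat ^ 'n. \<Sum>i\<in>UNIV. \<alpha> $ i * w i)"
  \<comment> \<open>The same weights serve both components, since conjugation commutes with
    \<open>t ^ w i\<close>.\<close>
  define e where "e = map_prod h h"
  have h_eqD: "\<alpha> = \<beta>" if "h \<alpha> = h \<beta>" "\<forall>i. \<alpha> $ i < N \<and> \<beta> $ i < N" for \<alpha> \<beta>
    using w[rule_format, of "($) \<alpha>" "($) \<beta>"] that by (auto simp: h_def vec_eq_iff)
  \<comment> \<open>If two exponents in the support collided, only the sum of their coefficients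
    could be recovered.\<close>
  have inj: "inj_on e ?S"
  proof (rule inj_onI, clarify)
    fix \<alpha> \<beta> \<alpha>' \<beta>'
    assume "(\<alpha>, \<beta>) \<in> ?S" "(\<alpha>', \<beta>') \<in> ?S" "e (\<alpha>, \<beta>) = e (\<alpha>', \<beta>')"
    then show "\<alpha> = \<alpha>' \<and> \<beta> = \<beta>'"
      using h_eqD[of \<alpha> \<alpha>'] h_eqD[of \<beta> \<beta>'] bnd by (simp add: e_def)
  qed
  define c where "c = (\<lambda>s. Poly_Mapping.lookup \<phi> (inv_into ?S e s))"
  have eval: "(\<Sum>s\<in>e ` ?S. c s * (cnj t ^ fst s * t ^ snd s)) = 0" for t
  proof -
    have pw: "mpow (\<chi> i. s ^ w i) \<alpha> = s ^ h \<alpha>" for s :: complex and \<alpha> :: "nat ^ 'n"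
      by (simp add: mpow_def h_def power_sum power_mult[symmetric] mult.commute)
    have "(\<Sum>s\<in>e ` ?S. c s * (cnj t ^ fst s * t ^ snd s)) =
        (\<Sum>p\<in>?S. Poly_Mapping.lookup \<phi> p * (cnj t ^ fst (e p) * t ^ snd (e p)))"
      by (simp add: sum.reindex[OF inj] c_def inv_into_f_f[OF inj])
    also have "\<dots> = ceval \<phi> (\<chi> i. t ^ w i)"
      by (simp add: ceval_def mpow_vcnj pw case_prod_unfold e_def mult.assoc)
    finally show ?thesis using 0 by simp
  qed
  have "Poly_Mapping.lookup \<phi> x = 0" if "x \<in> ?S"
    using sum_cnj_power_eq_0D[OF _ eval, of "e x"] that by (simp add: c_def inv_into_f_f[OF inj])
  then show "Poly_Mapping.lookup \<phi> x = Poly_Mapping.lookup 0 x"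
    by (auto simp: in_keys_iff)
qed

section \<open>Weak duality\<close>

text \<open>The squared modulus of the holomorphic polynomial with coefficients \<open>p\<close> up
  to degree \<open>d\<close>, as an element of the polynomial ring.\<close>

definition sq_cpoly :: "nat \<Rightarrow> (nat ^ 'n::finite \<Rightarrow> complex) \<Rightarrow> 'n cpoly"
  where "sq_cpoly d p =
    (\<Sum>\<alpha> | mdeg \<alpha> \<le> d. \<Sum>\<beta> | mdeg \<beta> \<le> d. Poly_Mapping.single (\<alpha>, \<beta>) (cnj (p \<alpha>) * p \<beta>))"

lemma riesz_mult_sq_cpoly:
  "riesz y (\<phi> * sq_cpoly d p) =
    (\<Sum>\<alpha> | mdeg \<alpha> \<le> d. \<Sum>\<beta> | mdeg \<beta> \<le> d. cnj (p \<alpha>) * loc_matrix \<phi> y \<alpha> \<beta> * p \<beta>)"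
  by (simp add: sq_cpoly_def sum_distrib_left riesz_sum riesz_mult_single_eq_loc_matrix mult_ac)

text \<open>This is the quadratic form of \<open>riesz_mult_sq_cpoly\<close> at the family
  \<open>dirac z\<close>, where the double sum factors.\<close>

lemma ceval_mult_sq_cpoly:
  "ceval (\<phi> * sq_cpoly d p) z =
    of_real ((cmod (\<Sum>\<alpha> | mdeg \<alpha> \<le> d. p \<alpha> * mpow z \<alpha>))\<^sup>2) * ceval \<phi> z"
proof -
  let ?s = "\<Sum>\<alpha> | mdeg \<alpha> \<le> d. p \<alpha> * mpow z \<alpha>"
  have "ceval (\<phi> * sq_cpoly d p) z = cnj ?s * ?s * ceval \<phi> z"
    unfolding ceval_eq_riesz[of "\<phi> * sq_cpoly d p"] riesz_mult_sq_cpoly loc_matrix_dirac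
    by (simp add: sum_product sum_distrib_left sum_distrib_right mult_ac)
  also have "cnj ?s * ?s = of_real ((cmod ?s)\<^sup>2)"
    by (rule cnj_mult_self)
  finally show ?thesis .
qed

text \<open>Sums of squares are given as functions, while the Riesz functional acts on ring
  elements. The polynomial \<open>s\<close> replaces \<open>\<sigma>\<close> and keeps the two
  properties that weak duality uses.\<close>

lemma Sigma_deg_representation:
  assumes "\<sigma> \<in> Sigma_deg d"
  obtains s where "\<And>\<phi> z. ceval (\<phi> * s) z = of_real (\<sigma> z) * ceval \<phi> z"
    and "\<And>\<phi> y. psd_on {\<alpha>. mdeg \<alpha> \<le> d} (loc_matrix \<phi> y) \<Longrightarrow> 0 \<le> Re (riesz y (\<phi> * s))"
proof -
  obtain r :: nat and q where q: "\<And>j. j \<in> {1..r} \<Longrightarrow> q j \<in> hol_polys d"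
    and \<sigma>: "\<sigma> = (\<lambda>z. \<Sum>j=1..r. (cmod (q j z))\<^sup>2)"
    using assms unfolding Sigma_deg_def sums_sq_def by blast
  have "\<forall>j\<in>{1..r}. \<exists>p. q j = (\<lambda>z. \<Sum>\<alpha> | mdeg \<alpha> \<le> d. p \<alpha> * mpow z \<alpha>)"
    using q unfolding hol_polys_def by blast
  then obtain p where p: "\<And>j. j \<in> {1..r} \<Longrightarrow> q j = (\<lambda>z. \<Sum>\<alpha> | mdeg \<alpha> \<le> d. p j \<alpha> * mpow z \<alpha>)"
    by metis
  define s where "s = (\<Sum>j=1..r. sq_cpoly d (p j))"
  show ?thesis
  proof
    show "ceval (\<phi> * s) z = of_real (\<sigma> z) * ceval \<phi> z" for \<phi> z
    proof -
      have "ceval (\<phi> * s) z = (\<Sum>j=1..r. ceval (\<phi> * sq_cpoly d (p j)) z)"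
        by (simp add: s_def ceval_eq_riesz sum_distrib_left riesz_sum)
      also have "\<dots> = (\<Sum>j=1..r. of_real ((cmod (q j z))\<^sup>2) * ceval \<phi> z)"
        by (intro sum.cong refl) (simp only: ceval_mult_sq_cpoly p)
      finally show ?thesis by (simp add: \<sigma> sum_distrib_right)
    qed
    show "0 \<le> Re (riesz y (\<phi> * s))" if "psd_on {\<alpha>. mdeg \<alpha> \<le> d} (loc_matrix \<phi> y)" for \<phi> y
      using that unfolding psd_on_def s_def sum_distrib_left riesz_sum riesz_mult_sq_cpoly Re_sum[of _ "{1..r}"]
      by (intro sum_nonneg) blast
  qed
qed

text \<open>The sets \<open>C i\<close> are a parameter so that the truncated and the full dual
  share one predicate.\<close>

definition dual_feasible ::
  "nat \<Rightarrow> 'n::finite cpoly \<Rightarrow> (nat \<Rightarrow> 'n cpoly) \<Rightarrow> (nat \<Rightarrow> (complex ^ 'n \<Rightarrow> real) set) \<Rightarrow> real \<Rightarrow> bool"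
  where "dual_feasible m f g C l \<longleftrightarrow> (\<exists>\<sigma>. (\<forall>i\<in>{0..m}. \<sigma> i \<in> C i) \<and>
      (\<forall>z. ceval f z - of_real l = (\<Sum>i=0..m. of_real (\<sigma> i z) * ceval ((g(0 := 1)) i) z)))"

lemma rho_dual_deg_eq:
  "rho_dual_deg m f g kg d =
    Sup {ereal l | l. dual_feasible m f g (\<lambda>i. Sigma_deg (d - (kg(0 := 0)) i)) l}"
  by (simp add: rho_dual_deg_def dual_feasible_def)

lemma rho_dual_eq: "rho_dual m f g = Sup {ereal l | l. dual_feasible m f g (\<lambda>_. Sigma_all) l}"
  by (simp add: rho_dual_def dual_feasible_def)

lemma dual_feasible_mono:
  assumes "dual_feasible m f g C l" "\<And>i. i \<in> {0..m} \<Longrightarrow> C i \<subseteq> D i"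
  shows "dual_feasible m f g D l"
  using assms unfolding dual_feasible_def by (meson subsetD)

text \<open>Fixing one level \<open>d\<close> makes the result applicable to both the truncated and
  the full moment problem.\<close>

lemma weak_duality:
  assumes y: "y 0 0 = 1" "moment_constraints m g kg d y"
    and l: "dual_feasible m f g (\<lambda>i. Sigma_deg (d - (kg(0 := 0)) i)) l"
  shows "l \<le> Re (riesz y f)"
proof -
  define G where "G = g(0 := 1)"
  obtain \<sigma> where \<sigma>: "\<forall>i\<in>{0..m}. \<sigma> i \<in> Sigma_deg (d - (kg(0 := 0)) i)"
    and eq: "\<And>z. ceval f z - of_real l = (\<Sum>i=0..m. of_real (\<sigma> i z) * ceval (G i) z)"
    using l unfolding dual_feasible_def G_def by blast
  have "\<forall>i\<in>{0..m}. \<exists>s. (\<forall>\<phi> z. ceval (\<phi> * s) z = of_real (\<sigma> i z) * ceval \<phi> z) \<and>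
      (\<forall>\<phi> y. psd_on {\<alpha>. mdeg \<alpha> \<le> d - (kg(0 := 0)) i} (loc_matrix \<phi> y) \<longrightarrow> 0 \<le> Re (riesz y (\<phi> * s)))"
    using \<sigma> by (metis Sigma_deg_representation)
  then obtain s where s: "\<forall>i\<in>{0..m}. (\<forall>\<phi> z. ceval (\<phi> * s i) z = of_real (\<sigma> i z) * ceval \<phi> z) \<and>
      (\<forall>\<phi> y. psd_on {\<alpha>. mdeg \<alpha> \<le> d - (kg(0 := 0)) i} (loc_matrix \<phi> y) \<longrightarrow> 0 \<le> Re (riesz y (\<phi> * s i)))"
    by metis
  \<comment> \<open>The certificate only says that the values of \<open>F\<close> vanish. Once
    \<open>F\<close> is zero in the ring, the Riesz functional of \<open>y\<close> may be applied to
    it.\<close>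
  define F where "F = f - Poly_Mapping.single (0, 0) (of_real l) - (\<Sum>i=0..m. G i * s i)"
  \<comment> \<open>Stated for every \<open>x\<close>, to be used at \<open>dirac z\<close> for the
    values and at \<open>y\<close> for the conclusion.\<close>
  have riesz_F: "riesz x F = riesz x f - of_real l * x 0 0 - (\<Sum>i=0..m. riesz x (G i * s i))" for x
    by (simp add: F_def riesz_diff riesz_single riesz_sum)
  have "ceval F z = 0" for z
  proof -
    have "ceval F z = ceval f z - of_real l - (\<Sum>i=0..m. ceval (G i * s i) z)"
      by (simp add: ceval_eq_riesz riesz_F dirac_def)
    also have "(\<Sum>i=0..m. ceval (G i * s i) z) = (\<Sum>i=0..m. of_real (\<sigma> i z) * ceval (G i) z)"
      using s by (intro sum.cong) auto
    finally show ?thesis by (simp add: eq)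
  qed
  then have "F = 0" by (rule ceval_eq_0D)
  then have "riesz y f - of_real l = (\<Sum>i=0..m. riesz y (G i * s i))"
    using riesz_F[of y] y(1) by simp
  then have "Re (riesz y f) - l = (\<Sum>i=0..m. Re (riesz y (G i * s i)))"
    by (metis Re_complex_of_real Re_sum minus_complex.sel(1))
  also have "\<dots> \<ge> 0"
    using s y(2) unfolding moment_constraints_def G_def by (intro sum_nonneg) blast
  finally show ?thesis by simp
qed

section \<open>Convergence of the dual values\<close>

lemma hol_polys_mono:
  assumes "d \<le> e"
  shows "hol_polys d \<subseteq> hol_polys e"
proof
  fix q :: "complex ^ 'n \<Rightarrow> complex" assume "q \<in> hol_polys d"
  then obtain p where p: "q = (\<lambda>z. \<Sum>\<alpha> | mdeg \<alpha> \<le> d. p \<alpha> * mpow z \<alpha>)"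
    unfolding hol_polys_def by blast
  define p' where "p' = (\<lambda>\<alpha> :: nat ^ 'n. if mdeg \<alpha> \<le> d then p \<alpha> else 0)"
  have "q = (\<lambda>z. \<Sum>\<alpha> | mdeg \<alpha> \<le> e. p' \<alpha> * mpow z \<alpha>)"
    unfolding p p'_def using assms
    by (intro ext sum.mono_neutral_cong_left) (auto simp: finite_mdeg_le)
  then show "q \<in> hol_polys e" unfolding hol_polys_def by blast
qed

lemma Sigma_deg_mono: "d \<le> e \<Longrightarrow> Sigma_deg d \<subseteq> Sigma_deg e"
  unfolding Sigma_deg_def sums_sq_def using hol_polys_mono by blast

lemma Sigma_deg_subset_Sigma_all: "Sigma_deg d \<subseteq> Sigma_all"
  unfolding Sigma_deg_def Sigma_all_def sums_sq_def by blast

text \<open>The summands are finite in number, so the sum of their degree bounds is a common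
  bound.\<close>

lemma Sigma_all_eq: "Sigma_all = (\<Union>d. Sigma_deg d)"
proof
  show "Sigma_all \<subseteq> (\<Union>d. Sigma_deg d :: (complex ^ 'n \<Rightarrow> real) set)"
  proof
    fix \<sigma> :: "complex ^ 'n \<Rightarrow> real" assume "\<sigma> \<in> Sigma_all"
    then obtain r :: nat and q where r: "r \<ge> 1" and q: "\<forall>j\<in>{1..r}. \<exists>d. q j \<in> hol_polys d"
      and \<sigma>: "\<sigma> = (\<lambda>z. \<Sum>j=1..r. (cmod (q j z))\<^sup>2)"
      unfolding Sigma_all_def sums_sq_def by blast
    from q obtain D where D: "\<forall>j\<in>{1..r}. q j \<in> hol_polys (D j)" by metis
    have "q j \<in> hol_polys (sum D {1..r})" if "j \<in> {1..r}" for j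
      using D hol_polys_mono[OF member_le_sum[OF that, of D]] that by auto
    then have "\<sigma> \<in> Sigma_deg (sum D {1..r})"
      unfolding Sigma_deg_def sums_sq_def using r \<sigma> by blast
    then show "\<sigma> \<in> (\<Union>d. Sigma_deg d)" by blast
  qed
qed (use Sigma_deg_subset_Sigma_all in blast)

lemma dual_feasible_Sigma_allD:
  assumes "dual_feasible m f g (\<lambda>_. Sigma_all) l"
  obtains d where "d \<ge> e" "dual_feasible m f g (\<lambda>i. Sigma_deg (d - K i)) l"
proof -
  obtain \<sigma> where \<sigma>: "\<forall>i\<in>{0..m}. \<exists>d. \<sigma> i \<in> Sigma_deg d"
    and eq: "\<forall>z. ceval f z - of_real l = (\<Sum>i=0..m. of_real (\<sigma> i z) * ceval ((g(0 := 1)) i) z)"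
    using assms unfolding dual_feasible_def Sigma_all_eq by blast
  from \<sigma> obtain D where D: "\<forall>i\<in>{0..m}. \<sigma> i \<in> Sigma_deg (D i)" by metis
  \<comment> \<open>The terms \<open>K i\<close> make up for the subtraction in
    \<open>d - K i\<close>, and \<open>e\<close> lifts \<open>d\<close> to the requested
    level.\<close>
  define d where "d = e + (\<Sum>i=0..m. D i + K i)"
  have "\<sigma> i \<in> Sigma_deg (d - K i)" if i: "i \<in> {0..m}" for i
  proof -
    have "D i \<le> d - K i"
      using member_le_sum[OF i, of "\<lambda>i. D i + K i"] by (simp add: d_def)
    then show ?thesis using D i Sigma_deg_mono by blast
  qed
  then have "dual_feasible m f g (\<lambda>i. Sigma_deg (d - K i)) l"
    unfolding dual_feasible_def using eq by blast
  then show ?thesis using that[of d] by (simp add: d_def)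
qed

text \<open>Truncated subtraction is monotone, so this holds below \<open>d_min\<close> as well, and
  the supremum may be taken over all levels.\<close>

lemma rho_dual_deg_mono: "mono (rho_dual_deg m f g kg)"
proof (rule monoI)
  fix d e :: nat assume "d \<le> e"
  have "dual_feasible m f g (\<lambda>i. Sigma_deg (e - (kg(0 := 0)) i)) l"
    if "dual_feasible m f g (\<lambda>i. Sigma_deg (d - (kg(0 := 0)) i)) l" for l
    using that by (rule dual_feasible_mono) (intro Sigma_deg_mono diff_le_mono \<open>d \<le> e\<close>)
  then show "rho_dual_deg m f g kg d \<le> rho_dual_deg m f g kg e"
    unfolding rho_dual_deg_eq by (intro Sup_subset_mono) blast
qed

lemma rho_dual_eq_SUP: "rho_dual m f g = (SUP d. rho_dual_deg m f g kg d)"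
proof (rule antisym)
  show "rho_dual m f g \<le> (SUP d. rho_dual_deg m f g kg d)"
    unfolding rho_dual_eq
  proof (rule Sup_least, clarify)
    fix l assume "dual_feasible m f g (\<lambda>_. Sigma_all) l"
    then obtain d where "dual_feasible m f g (\<lambda>i. Sigma_deg (d - (kg(0 := 0)) i)) l"
      by (rule dual_feasible_Sigma_allD)
    then have "ereal l \<le> rho_dual_deg m f g kg d"
      unfolding rho_dual_deg_eq by (intro Sup_upper) blast
    then show "ereal l \<le> (SUP d. rho_dual_deg m f g kg d)"
      by (rule SUP_upper2[OF UNIV_I])
  qed
  show "(SUP d. rho_dual_deg m f g kg d) \<le> rho_dual m f g"
  proof (rule SUP_least)
    fix d
    have "dual_feasible m f g (\<lambda>_. Sigma_all) l"
      if "dual_feasible m f g (\<lambda>i. Sigma_deg (d - (kg(0 := 0)) i)) l" for l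
      using that Sigma_deg_subset_Sigma_all by (rule dual_feasible_mono)
    then show "rho_dual_deg m f g kg d \<le> rho_dual m f g"
      unfolding rho_dual_deg_eq rho_dual_eq by (intro Sup_subset_mono) blast
  qed
qed

section \<open>Comparison of the dual, moment and original values\<close>

lemma rho_dual_deg_le_rho_deg: "rho_dual_deg m f g kg d \<le> rho_deg m f g kg d"
  unfolding rho_dual_deg_eq rho_deg_def
  by (intro Sup_least INF_greatest) (clarsimp simp del: fun_upd_apply, rule weak_duality)

text \<open>A certificate of the full dual already lives at some level above \<open>d_min\<close>,
  where \<open>y\<close> satisfies the moment constraints.\<close>

lemma rho_dual_le_rho: "rho_dual m f g \<le> rho m f g k kg"
  unfolding rho_dual_eq rho_def
proof (intro Sup_least INF_greatest, clarify)
  fix l y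
  assume "dual_feasible m f g (\<lambda>_. Sigma_all) l" and y: "y 0 0 = 1"
    and mc: "\<forall>d\<ge>d_min m k kg. moment_constraints m g kg d y"
  then obtain d where "d \<ge> d_min m k kg"
    "dual_feasible m f g (\<lambda>i. Sigma_deg (d - (kg(0 := 0)) i)) l"
    by (elim dual_feasible_Sigma_allD)
  then show "ereal l \<le> ereal (Re (riesz y f))"
    using weak_duality[where d = d] y mc unfolding ereal_less_eq by blast
qed

text \<open>The point mass at a feasible \<open>z\<close> is a feasible family with objective value
  \<open>Re (ceval f z)\<close>. On an empty feasible set the right side is infinite.\<close>

lemma rho_le_f_opt:
  assumes "\<And>i z. i \<in> {1..m} \<Longrightarrow> ceval (g i) z \<in> \<real>"
  shows "rho m f g k kg \<le> f_opt m f g"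
  unfolding f_opt_def
proof (rule INF_greatest)
  fix z assume z: "z \<in> feasible_set m g"
  have "moment_constraints m g kg d (dirac z)" for d
    using z assms unfolding moment_constraints_def feasible_set_def
    by (auto intro!: psd_on_dirac)
  moreover have "dirac z \<in> herm_seqs" "dirac z 0 0 = 1"
    by (auto simp: herm_seqs_def dirac_def mpow_vcnj mult.commute)
  ultimately show "rho m f g k kg \<le> ereal (Re (ceval f z))"
    unfolding rho_def ceval_eq_riesz by (intro INF_lower) auto
qed

theorem proposition3p2:
  fixes f :: "'n::finite cpoly"
    and g :: "nat \<Rightarrow> 'n cpoly"
    and m k :: nat
    and kg :: "nat \<Rightarrow> nat"
  assumes m: "m \<ge> 1"
    and f: "has_cdegree f k"
    and g: "\<And>i. i \<in> {1..m} \<Longrightarrow> has_cdegree (g i) (kg i)"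
    and K: "compact (feasible_set m g)"
  shows "(\<forall>d\<ge>d_min m k kg. rho_dual_deg m f g kg d \<le> rho_deg m f g kg d) \<and>
    (\<lambda>d. rho_dual_deg m f g kg d) \<longlonglongrightarrow> rho_dual m f g \<and>
    rho_dual m f g \<le> rho m f g k kg \<and>
    rho m f g k kg \<le> f_opt m f g"
proof (intro conjI allI impI)
  show "rho_dual_deg m f g kg d \<le> rho_deg m f g kg d" for d
    by (rule rho_dual_deg_le_rho_deg)
  show "(\<lambda>d. rho_dual_deg m f g kg d) \<longlonglongrightarrow> rho_dual m f g"
    unfolding rho_dual_eq_SUP[of m f g kg] by (rule LIMSEQ_SUP[OF rho_dual_deg_mono])
  show "rho_dual m f g \<le> rho m f g k kg"
    by (rule rho_dual_le_rho)
  show "rho m f g k kg \<le> f_opt m f g"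
    using g by (intro rho_le_f_opt) (auto simp: has_cdegree_def real_cpolys_def)
qed

end
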